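(* Let $X_1,\ldots,X_n$ be locally dependent Bernoulli random variables with $\mathbb{P}(X_i=1)=p_i=1-\mathbb{P}(X_i=0)$ and neighbourhoods $A_i\subseteq B_i$ (as described in the context), let $W_n=\sum_{i=1}^n X_i$ and $W_i=\sum_{j\notin A_i}X_j$, and let $$p=\frac1n\sum_{i=1}^n p_i,\qquad q=1-p,\qquad 0<p<1.$$ Let $\mathrm{B}_{n,p}$ be a binomial random variable with parameters $n$ and $p$. Then $$d_{sl}(W_n,\mathrm{B}_{n,p})\le \frac{2}{pq^n}\sum_{i=1}^{n}\left[\mathbb{E}\left((X_i+p_i)q^{W_i}\right)-\mathbb{E}\left((p_i+qX_i)q^{W_n}\right)\right].$$
   Context: Local dependence: for each $i\in\{1,\ldots,n\}$ there are subsets $A_i,B_i$ of $\{1,\ldots,n\}$ with $i\in A_i\subseteq B_i$ such that $X_i$ is independent of the collection $\{X_j: j\in A_i^c\}$, and the collection $\{X_j:j\in A_i\}$ is independent of the collection $\{X_j:j\in B_i^c\}$, where $A^c$ denotes the complement of $A$ in $\{1,\ldots,n\}$. $\mathrm{B}_{n,p}$ has $\mathbb{P}(\mathrm{B}_{n,p}=k)=\binom{n}{k}p^kq^{n-k}$, $k=0,\ldots,n$. The stop-loss metric is $d_{sl}(X,Y)=\sup_{z\in\mathbb{R}}\left|\mathbb{E}[(X-z)^+]-\mathbb{E}[(Y-z)^+]\right|$, where $x^+=\max\{x,0\}$. *)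

theory Defs
  imports "HOL-Probability.Probability"
begin

text \<open>
  Independence of the two collections \<open>{X i | i \<in> I}\<close> and \<open>{X j | j \<in> J}\<close>: each collection is read as
  a single random element of the product space. A single variable \<open>X i\<close> is the collection indexed by
  \<open>{i}\<close>, because \<^const>\<open>prob_space.indep_var\<close> requires both random elements to have the same type.
\<close>

definition (in prob_space) indep_collections ::
  "('i \<Rightarrow> 'a \<Rightarrow> nat) \<Rightarrow> 'i set \<Rightarrow> 'i set \<Rightarrow> bool" where
  "indep_collections X I J \<longleftrightarrow>
     indep_var (PiM I (\<lambda>_. count_space UNIV)) (\<lambda>\<omega>. \<lambda>i\<in>I. X i \<omega>)
               (PiM J (\<lambda>_. count_space UNIV)) (\<lambda>\<omega>. \<lambda>j\<in>J. X j \<omega>)"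

definition (in prob_space) locally_dependent ::
  "nat \<Rightarrow> (nat \<Rightarrow> 'a \<Rightarrow> nat) \<Rightarrow> (nat \<Rightarrow> nat set) \<Rightarrow> (nat \<Rightarrow> nat set) \<Rightarrow> bool" where
  "locally_dependent n X A B \<longleftrightarrow>
     (\<forall>i\<in>{1..n}. i \<in> A i \<and> A i \<subseteq> B i \<and> B i \<subseteq> {1..n} \<and>
        indep_collections X {i} ({1..n} - A i) \<and>
        indep_collections X (A i) ({1..n} - B i))"

definition (in prob_space) bernoulli_rv :: "('a \<Rightarrow> nat) \<Rightarrow> real \<Rightarrow> bool" where
  "bernoulli_rv X r \<longleftrightarrow> random_variable (count_space UNIV) X \<and>
     prob {\<omega> \<in> space M. X \<omega> = 1} = r \<and> prob {\<omega> \<in> space M. X \<omega> = 0} = 1 - r"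

text \<open>
  The variables may live on different probability spaces. The supremum is taken in the extended
  reals, so it is meaningful even where the set of differences is unbounded.
\<close>

definition stop_loss_dist ::
  "'a measure \<Rightarrow> ('a \<Rightarrow> real) \<Rightarrow> 'b measure \<Rightarrow> ('b \<Rightarrow> real) \<Rightarrow> ereal" where
  "stop_loss_dist M X N Y =
     (SUP z::real. ereal \<bar>(\<integral>\<omega>. max (X \<omega> - z) 0 \<partial>M) - (\<integral>\<omega>. max (Y \<omega> - z) 0 \<partial>N)\<bar>)"

end

theory Submission
  imports Defs
begin

text \<open>
  The proof is Stein's method for the binomial law. Fix a retention \<open>z\<close>, put
  \<open>h(k) = max (k - z) 0\<close> and let \<open>m\<close> be the mean of \<open>h\<close> under the binomial law with parameters \<open>n\<close>
  and \<open>p\<close>. With \<open>q = 1 - p\<close>, the Stein equation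
  \<open>p (n - k) f(k + 1) - q k f(k) = h(k) - m\<close> has a solution on \<open>{0..n}\<close>
  (\<open>binomial_stein_equation\<close>). Differencing it twice gives an elliptic equation for the increments of
  \<open>f\<close>, with the second difference of \<open>h\<close> as source term; a discrete maximum principle then bounds the
  increments by half the size of that source (\<open>binomial_stein_increment_le\<close>). Since the second
  difference of a stop-loss function lies between 0 and 1, the function \<open>f\<close> is Lipschitz with constant
  1/2.

  Writing \<open>F\<close> for \<open>f\<close> continued constantly beyond \<open>n\<close> and evaluating the equation at \<open>W\<close>, one
  obtains \<open>h(W) - m\<close> as the sum over \<open>i\<close> of \<open>p_i F(W + 1) - X_i (p F(W + 1) + q F(W))\<close>. Independence
  of \<open>X_i\<close> and \<open>W_i\<close> (\<open>indep_collections_expectation_mult\<close>) allows adding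
  \<open>(X_i - p_i) F(W_i + 1)\<close>, which has mean zero, to the \<open>i\<close>-th summand. What remains
  consists of differences of \<open>F\<close> between points at distance at most \<open>W - W_i\<close>, so each
  summand is at most \<open>(p_i + X_i) (W - W_i) / 2\<close> in absolute value. Finally, by
  \<open>power_gap_ge\<close>, the distance \<open>W - W_i\<close> is at most \<open>(q^{W_i} - q^W) / (p q^n)\<close>, which produces the
  right-hand side of the theorem with room to spare.
\<close>

section \<open>The Stein equation of the binomial distribution\<close>

text \<open>
  The binomial weights \<open>w\<close> satisfy the detailed balance relation
  \<open>p (n - k) w(k) = (1 - p) (k + 1) w(k + 1)\<close>. After multiplication by \<open>w(k)\<close> the left-hand side of
  the equation therefore becomes a difference of consecutive values of \<open>(1 - p) k w(k) f(k)\<close>, so \<open>f\<close>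
  is found by summation. Centring \<open>h\<close> makes the total sum vanish, which is the condition at \<open>k = n\<close>,
  where the coefficient of \<open>f(n + 1)\<close> is zero.
\<close>

lemma binomial_stein_equation:
  fixes h :: "nat \<Rightarrow> real" and p :: real
  assumes p: "0 < p" "p < 1"
  obtains f where "\<And>k. k \<le> n \<Longrightarrow>
    p * (real n - real k) * f (Suc k) - (1 - p) * real k * f k
      = h k - measure_pmf.expectation (binomial_pmf n p) h"
proof -
  define w where "w k = real (n choose k) * p ^ k * (1 - p) ^ (n - k)" for k
  define m where "m = measure_pmf.expectation (binomial_pmf n p) h"
  define S where "S k = (\<Sum>j<k. w j * (h j - m))" for k
  define f where "f k = S k / ((1 - p) * real k * w k)" for k
  have w_pos: "w k > 0" if "k \<le> n" for k
    using p that by (simp add: w_def)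
  have balance: "p * (real n - real k) * w k = (1 - p) * real (Suc k) * w (Suc k)" if "k < n" for k
  proof -
    have "real (Suc k) * real (n choose Suc k) = real ((n choose k) * (n - k))"
      by (metis binomial_absorb_comp binomial_absorption mult.commute of_nat_mult)
    hence "real (Suc k) * real (n choose Suc k) = real (n choose k) * (real n - real k)"
      using that by (simp add: of_nat_diff)
    moreover have "(1 - p) ^ (n - k) = (1 - p) * (1 - p) ^ (n - Suc k)"
      using that by (metis Suc_diff_Suc power_Suc)
    moreover have "(1 - p) * real (Suc k) * w (Suc k)
        = (1 - p) * p * p ^ k * (1 - p) ^ (n - Suc k) * (real (Suc k) * real (n choose Suc k))"
      by (simp add: w_def mult_ac)
    ultimately show ?thesis
      by (simp add: w_def mult_ac)
  qed
  have m_eq: "m = (\<Sum>j\<le>n. w j * h j)"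
    using p by (simp add: m_def w_def expectation_binomial_pmf' mult_ac)
  have w_sum: "(\<Sum>j\<le>n. w j) = 1"
    using binomial_ring[of p "1 - p" n] by (simp add: w_def)
  have S_end: "S (Suc n) = 0"
    by (simp add: S_def lessThan_Suc_atMost right_diff_distrib sum_subtractf
          sum_distrib_right[symmetric] w_sum m_eq[symmetric])
  have S_step: "S (Suc k) - S k = w k * (h k - m)" for k
    by (simp add: S_def)
  have up: "p * (real n - real k) * f (Suc k) = S (Suc k) / w k" if "k \<le> n" for k
  proof (cases "k = n")
    case True
    thus ?thesis by (simp add: S_end)
  next
    case False
    hence "k < n" using that by simp
    have "w k > 0" "w (Suc k) > 0" using w_pos \<open>k < n\<close> by auto
    have "f (Suc k) = S (Suc k) / (p * (real n - real k) * w k)"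
      by (simp only: f_def balance[OF \<open>k < n\<close>])
    thus ?thesis using p \<open>k < n\<close> \<open>w k > 0\<close> by (simp add: field_simps)
  qed
  have down: "(1 - p) * real k * f k = S k / w k" if "k \<le> n" for k
    using p w_pos[OF that] by (cases "k = 0") (auto simp: f_def S_def)
  show thesis
  proof (rule that)
    fix k assume "k \<le> n"
    have "p * (real n - real k) * f (Suc k) - (1 - p) * real k * f k = (S (Suc k) - S k) / w k"
      using up[OF \<open>k \<le> n\<close>] down[OF \<open>k \<le> n\<close>] by (simp add: diff_divide_distrib)
    also have "\<dots> = h k - m"
      using w_pos[OF \<open>k \<le> n\<close>] by (simp add: S_step)
    finally show "p * (real n - real k) * f (Suc k) - (1 - p) * real k * f k
      = h k - measure_pmf.expectation (binomial_pmf n p) h" by (simp add: m_def)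
  qed
qed

text \<open>
  A discrete maximum principle. With \<open>d(k) = f(k + 1) - f(k)\<close>, the second difference of the Stein
  equation at \<open>i\<close> reads
  \<open>p (n - i - 2) (d(i + 2) - d(i + 1)) - (1 - p) i (d(i + 1) - d(i)) - 2 d(i + 1) = \<Delta>\<^sup>2 h(i)\<close>.
  Where \<open>d(i + 1)\<close> is maximal, the first two terms are not positive, so \<open>-2 d(i + 1) \<ge> -c\<close>. No boundary
  values intervene: the coefficients of \<open>d(n)\<close> and \<open>d(0)\<close> vanish.
\<close>

lemma binomial_stein_increment_le:
  fixes f h :: "nat \<Rightarrow> real" and p c m :: real
  assumes p: "0 \<le> p" "p \<le> 1"
    and stein: "\<And>k. k \<le> n \<Longrightarrow>
      p * (real n - real k) * f (Suc k) - (1 - p) * real k * f k = h k - m"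
    and h: "\<And>k. k + 2 \<le> n \<Longrightarrow> - c \<le> h (k + 2) - 2 * h (k + 1) + h k"
    and k: "1 \<le> k" "k < n"
  shows "f (Suc k) - f k \<le> c / 2"
proof -
  define d where "d k = f (Suc k) - f k" for k
  obtain l where l: "l \<in> {1..<n}" "\<And>j. j \<in> {1..<n} \<Longrightarrow> d j \<le> d l"
  proof -
    have "finite (d ` {1..<n})" "d ` {1..<n} \<noteq> {}" using k by auto
    from Max_in[OF this] Max_ge[OF this(1)] that show thesis by (metis imageE imageI)
  qed
  define i where "i = l - 1"
  have i: "l = Suc i" "i + 2 \<le> n" using l(1) by (auto simp: i_def)
  have second_difference: "p * (real n - real i - 2) * (d (i + 2) - d (i + 1))
      - (1 - p) * real i * (d (i + 1) - d i) - 2 * d (i + 1)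
      = h (i + 2) - 2 * h (i + 1) + h i"
    using stein[of i] stein[of "i + 1"] stein[of "i + 2"] i(2)
    by (simp add: d_def numeral_2_eq_2) (simp add: algebra_simps)
  have "p * (real n - real i - 2) * (d (i + 2) - d (i + 1)) \<le> 0"
  proof (cases "i + 2 = n")
    case True
    hence "real n - real i - 2 = 0" by linarith
    thus ?thesis by simp
  next
    case False
    hence "i + 2 < n" using i(2) by simp
    hence "d (i + 2) \<le> d (i + 1)" "real n - real i - 2 \<ge> 0" using l(2)[of "i + 2"] i by auto
    thus ?thesis using p by (intro mult_nonneg_nonpos) auto
  qed
  moreover have "(1 - p) * real i * (d (i + 1) - d i) \<ge> 0"
  proof (cases "i = 0")
    case False
    hence "d i \<le> d (i + 1)" using l(2)[of i] i by auto
    thus ?thesis using p by simp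
  qed simp
  ultimately have "- c \<le> - 2 * d (i + 1)"
    using second_difference h[OF i(2)] by linarith
  hence "d l \<le> c / 2" using i by simp
  moreover have "d k \<le> d l" using l(2) k by simp
  ultimately show ?thesis by (simp add: d_def)
qed

text \<open>
  The Stein equation is linear, so the one-sided estimate applies to \<open>-f\<close> and \<open>-h\<close> as well. Truncating
  the argument at \<open>n\<close> continues \<open>f\<close> constantly, since the equation leaves \<open>f(n + 1)\<close> arbitrary.
  The restriction \<open>1 \<le> a\<close> is essential because \<open>f(0)\<close> is equally arbitrary.
\<close>

lemma binomial_stein_lipschitz:
  fixes f h :: "nat \<Rightarrow> real" and p c m :: real
  assumes p: "0 \<le> p" "p \<le> 1"
    and stein: "\<And>k. k \<le> n \<Longrightarrow>
      p * (real n - real k) * f (Suc k) - (1 - p) * real k * f k = h k - m"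
    and h: "\<And>k. k + 2 \<le> n \<Longrightarrow> \<bar>h (k + 2) - 2 * h (k + 1) + h k\<bar> \<le> c"
    and c: "0 \<le> c" and a: "1 \<le> a" "a \<le> b"
  shows "\<bar>f (min b n) - f (min a n)\<bar> \<le> c / 2 * (real b - real a)"
  using \<open>a \<le> b\<close>
proof (induction b rule: dec_induct)
  case (step b)
  have "\<bar>f (min (Suc b) n) - f (min b n)\<bar> \<le> c / 2"
  proof (cases "b < n")
    case True
    have "f (Suc b) - f b \<le> c / 2"
    proof (rule binomial_stein_increment_le[OF p stein])
      show "- c \<le> h (k + 2) - 2 * h (k + 1) + h k" if "k + 2 \<le> n" for k
        using h[OF that] by linarith
    qed (use True a step(1) in auto)
    moreover have "(- f (Suc b)) - (- f b) \<le> c / 2"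
    proof (rule binomial_stein_increment_le[OF p, where h = "\<lambda>k. - h k" and m = "- m"])
      show "p * (real n - real k) * (- f (Suc k)) - (1 - p) * real k * (- f k) = - h k - - m"
        if "k \<le> n" for k using stein[OF that] by simp
      show "- c \<le> - h (k + 2) - 2 * - h (k + 1) + - h k" if "k + 2 \<le> n" for k
        using h[OF that] by linarith
    qed (use True a step(1) in auto)
    ultimately have "\<bar>f (Suc b) - f b\<bar> \<le> c / 2" by linarith
    thus ?thesis using True by (simp add: min_def)
  next
    case False
    thus ?thesis using c by simp
  qed
  moreover have "c / 2 * (real (Suc b) - real a) = c / 2 * (real b - real a) + c / 2"
    by (simp add: field_simps)
  ultimately show ?case using step.IH by linarith
qed simp

section \<open>Locally dependent Bernoulli sums\<close>

text \<open>
  Each of the \<open>b - a\<close> consecutive drops \<open>q^j - q^{j+1} = (1 - q) q^j\<close> is at least \<open>(1 - q) q^n\<close>. This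
  converts the linear Lipschitz bound into the geometric form of the final estimate.
\<close>

lemma power_gap_ge:
  fixes q :: real
  assumes q: "0 \<le> q" "q \<le> 1" and "a \<le> b" "b \<le> n"
  shows "(real b - real a) * ((1 - q) * q ^ n) \<le> q ^ a - q ^ b"
  using \<open>a \<le> b\<close> \<open>b \<le> n\<close>
proof (induction b rule: dec_induct)
  case (step b)
  have "(1 - q) * q ^ n \<le> (1 - q) * q ^ b"
    using q step by (intro mult_left_mono power_decreasing) auto
  thus ?case using step by (simp add: algebra_simps)
qed simp

text \<open>
  Independence of the whole collection passes to its sum: a function of the sum over \<open>J\<close> is a measurable function of
  the collection indexed by \<open>J\<close>, hence independent of the single variable.
\<close>

lemma (in prob_space) indep_collections_expectation_mult:
  fixes X :: "nat \<Rightarrow> 'a \<Rightarrow> nat" and G :: "nat \<Rightarrow> real"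
  assumes indep: "indep_collections X {i} J" and "finite J"
    and int_X: "integrable M (\<lambda>\<omega>. real (X i \<omega>))"
    and G: "bounded (range G)"
  shows "expectation (\<lambda>\<omega>. real (X i \<omega>) * G (\<Sum>j\<in>J. X j \<omega>))
    = expectation (\<lambda>\<omega>. real (X i \<omega>)) * expectation (\<lambda>\<omega>. G (\<Sum>j\<in>J. X j \<omega>))"
proof -
  let ?P = "\<lambda>I. PiM I (\<lambda>_. count_space UNIV) :: (nat \<Rightarrow> nat) measure"
  have indep': "indep_var (?P {i}) (\<lambda>\<omega>. \<lambda>k\<in>{i}. X k \<omega>) (?P J) (\<lambda>\<omega>. \<lambda>j\<in>J. X j \<omega>)"
    using indep by (simp add: indep_collections_def)
  have sum_meas: "(\<lambda>x. G (\<Sum>j\<in>J. x j)) \<in> borel_measurable (?P J)"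
  proof -
    have "(\<lambda>x. \<Sum>j\<in>J. x j) \<in> measurable (?P J) (count_space UNIV)"
    proof -
      have "(\<lambda>x. x j) \<in> borel_measurable (?P J)" if "j \<in> J" for j
        using measurable_component_singleton[OF that, of "\<lambda>_. count_space (UNIV :: nat set)"]
        by (simp add: measurable_cong_sets[OF refl sets_borel_eq_count_space])
      hence "(\<lambda>x. \<Sum>j\<in>J. x j) \<in> borel_measurable (?P J)" by (intro borel_measurable_sum)
      thus ?thesis by (simp add: measurable_cong_sets[OF refl sets_borel_eq_count_space])
    qed
    thus ?thesis by (rule measurable_compose) simp
  qed
  have "(\<lambda>x. real (x i)) \<in> borel_measurable (?P {i})"
    by (rule measurable_compose[OF measurable_component_singleton]) auto
  from indep_var_compose[OF indep' this sum_meas]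
  have ind: "indep_var borel (\<lambda>\<omega>. real (X i \<omega>)) borel (\<lambda>\<omega>. G (\<Sum>j\<in>J. X j \<omega>))"
    by (simp add: comp_def)
  obtain C where "\<And>k. \<bar>G k\<bar> \<le> C" using G by (auto simp: bounded_iff)
  hence "integrable M (\<lambda>\<omega>. G (\<Sum>j\<in>J. X j \<omega>))"
    using indep_var_rv2[OF ind] by (intro integrable_const_bound[where B = C]) auto
  thus ?thesis by (rule indep_var_lebesgue_integral[OF ind int_X])
qed

theorem theorem3p1:
  fixes M :: "'a measure" and N :: "'b measure"
    and n :: nat and X :: "nat \<Rightarrow> 'a \<Rightarrow> nat" and A B :: "nat \<Rightarrow> nat set"
    and p :: "nat \<Rightarrow> real" and pbar q :: real
    and W :: "'a \<Rightarrow> nat" and Wi :: "nat \<Rightarrow> 'a \<Rightarrow> nat" and Bin :: "'b \<Rightarrow> nat"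
  assumes M: "prob_space M" and N: "prob_space N"
    and bern: "\<And>i. i \<in> {1..n} \<Longrightarrow> prob_space.bernoulli_rv M (X i) (p i)"
    and dep: "prob_space.locally_dependent M n X A B"
    and W: "W = (\<lambda>\<omega>. \<Sum>i=1..n. X i \<omega>)"
    and Wi: "Wi = (\<lambda>i \<omega>. \<Sum>j\<in>{1..n} - A i. X j \<omega>)"
    and pbar: "pbar = (1 / real n) * (\<Sum>i=1..n. p i)"
    and q: "q = 1 - pbar"
    and pbar_bounds: "0 < pbar" "pbar < 1"
    and Bin: "Bin \<in> measurable N (count_space UNIV)"
      "distr N (count_space UNIV) Bin = measure_pmf (binomial_pmf n pbar)"
  shows "stop_loss_dist M (\<lambda>\<omega>. real (W \<omega>)) N (\<lambda>\<omega>. real (Bin \<omega>))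
    \<le> ereal (2 / (pbar * q ^ n) *
        (\<Sum>i=1..n. (\<integral>\<omega>. (real (X i \<omega>) + p i) * q ^ Wi i \<omega> \<partial>M)
                  - (\<integral>\<omega>. (p i + q * real (X i \<omega>)) * q ^ W \<omega> \<partial>M)))"
proof -
  interpret M: prob_space M by fact
  have meas_X [measurable]: "X i \<in> measurable M (count_space UNIV)" if "i \<in> {1..n}" for i
    using bern[OF that] by (simp add: M.bernoulli_rv_def)
  have X01: "AE \<omega> in M. X i \<omega> = 0 \<or> X i \<omega> = 1" if i: "i \<in> {1..n}" for i
  proof -
    note [measurable] = meas_X[OF i]
    have "M.prob ({\<omega> \<in> space M. X i \<omega> = 1} \<union> {\<omega> \<in> space M. X i \<omega> = 0}) = 1"
      using bern[OF i] by (subst M.finite_measure_Union) (auto simp: M.bernoulli_rv_def)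
    from M.AE_prob_1[OF this] show ?thesis by eventually_elim auto
  qed
  have AE01: "AE \<omega> in M. \<forall>i\<in>{1..n}. X i \<omega> = 0 \<or> X i \<omega> = 1"
    by (rule AE_finite_allI) (use X01 in auto)
  have AE_W_le: "AE \<omega> in M. W \<omega> \<le> n"
    using AE01
  proof eventually_elim
    case (elim \<omega>)
    have "W \<omega> \<le> (\<Sum>i=1..n. 1)" unfolding W using elim by (intro sum_mono) fastforce
    thus ?case by simp
  qed
  have int_X: "integrable M (\<lambda>\<omega>. real (X i \<omega>))" if "i \<in> {1..n}" for i
  proof (rule M.integrable_const_bound[where B = 1])
    show "AE \<omega> in M. norm (real (X i \<omega>)) \<le> 1" using X01[OF that] by eventually_elim auto
    show "(\<lambda>\<omega>. real (X i \<omega>)) \<in> borel_measurable M"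
      by (rule measurable_compose[OF meas_X[OF that]]) simp
  qed
  have exp_X: "M.expectation (\<lambda>\<omega>. real (X i \<omega>)) = p i" if i: "i \<in> {1..n}" for i
  proof -
    note [measurable] = meas_X[OF i]
    have "M.expectation (\<lambda>\<omega>. real (X i \<omega>))
        = M.expectation (indicator {\<omega> \<in> space M. X i \<omega> = 1})"
      by (rule integral_cong_AE) (use X01[OF i] in \<open>auto elim!: eventually_mono simp: indicator_def\<close>)
    also have "\<dots> = p i" using bern[OF i] by (simp add: M.bernoulli_rv_def)
    finally show ?thesis .
  qed
  have p_nonneg: "0 \<le> p i" if "i \<in> {1..n}" for i
    using bern[OF that] measure_nonneg[of M] by (metis M.bernoulli_rv_def)
  have q01: "0 < q" "q < 1" "pbar = 1 - q" using pbar_bounds q by auto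
  have "n > 0" using pbar pbar_bounds by (cases n) auto
  have sum_p: "(\<Sum>i=1..n. p i) = real n * pbar"
    using pbar \<open>n > 0\<close> by simp

  have meas_sum: "(\<lambda>\<omega>. \<Sum>j\<in>J. X j \<omega>) \<in> measurable M (count_space UNIV)" if "J \<subseteq> {1..n}" for J
  proof -
    have "(\<lambda>\<omega>. \<Sum>j\<in>J. X j \<omega>) \<in> borel_measurable M"
      using that by (intro borel_measurable_sum)
        (auto simp: measurable_cong_sets[OF refl sets_borel_eq_count_space])
    thus ?thesis by (simp add: measurable_cong_sets[OF refl sets_borel_eq_count_space])
  qed
  have meas_W [measurable]: "W \<in> measurable M (count_space UNIV)"
    unfolding W by (rule meas_sum) simp
  have meas_Wi [measurable]: "Wi i \<in> measurable M (count_space UNIV)" for i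
    unfolding Wi by (rule meas_sum) auto

  \<comment> \<open>the integrand whose expectation is the \<open>i\<close>-th summand of the bound\<close>
  define R where "R i \<omega> = (real (X i \<omega>) + p i) * q ^ Wi i \<omega> - (p i + q * real (X i \<omega>)) * q ^ W \<omega>"
    for i \<omega>
  have int_bdd: "integrable M (\<lambda>\<omega>. G (V \<omega>))"
    if "V \<in> measurable M (count_space UNIV)" "\<And>k. \<bar>G k\<bar> \<le> C"
    for V :: "'a \<Rightarrow> nat" and G :: "nat \<Rightarrow> real" and C
    using that by (intro M.integrable_const_bound[where B = C]) auto
  have int_X_bdd: "integrable M (\<lambda>\<omega>. real (X i \<omega>) * G (V \<omega>))"
    if i: "i \<in> {1..n}" and [measurable]: "V \<in> measurable M (count_space UNIV)"
      and C: "\<And>k. \<bar>G k\<bar> \<le> C"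
    for i and V :: "'a \<Rightarrow> nat" and G :: "nat \<Rightarrow> real" and C
  proof (rule Bochner_Integration.integrable_bound)
    note [measurable] = meas_X[OF i]
    show "integrable M (\<lambda>\<omega>. C * real (X i \<omega>))" using int_X[OF i] by simp
    show "(\<lambda>\<omega>. real (X i \<omega>) * G (V \<omega>)) \<in> borel_measurable M" by measurable
    have "0 \<le> C" using C[of 0] by linarith
    show "AE \<omega> in M. norm (real (X i \<omega>) * G (V \<omega>)) \<le> norm (C * real (X i \<omega>))"
      using C \<open>0 \<le> C\<close> by (auto simp: abs_mult mult.commute intro!: mult_mono)
  qed
  have q_pow: "\<bar>q ^ k\<bar> \<le> 1" for k using q01 by (simp add: power_le_one)
  have int_R1: "integrable M (\<lambda>\<omega>. (real (X i \<omega>) + p i) * q ^ Wi i \<omega>)"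
    and int_R2: "integrable M (\<lambda>\<omega>. (p i + q * real (X i \<omega>)) * q ^ W \<omega>)" if i: "i \<in> {1..n}" for i
    using int_X_bdd[OF i meas_Wi, of "\<lambda>k. q ^ k", OF q_pow] int_X_bdd[OF i meas_W, of "\<lambda>k. q ^ k", OF q_pow]
      int_bdd[OF meas_Wi, of "\<lambda>k. q ^ k", OF q_pow] int_bdd[OF meas_W, of "\<lambda>k. q ^ k", OF q_pow]
    by (auto simp: distrib_right mult.assoc)
  have int_R: "integrable M (R i)"
    and exp_R: "M.expectation (R i) = (\<integral>\<omega>. (real (X i \<omega>) + p i) * q ^ Wi i \<omega> \<partial>M)
                  - (\<integral>\<omega>. (p i + q * real (X i \<omega>)) * q ^ W \<omega> \<partial>M)" if i: "i \<in> {1..n}" for i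
    using int_R1[OF i] int_R2[OF i] unfolding R_def by auto

  have bound: "\<bar>(\<integral>\<omega>. max (real (W \<omega>) - z) 0 \<partial>M) - (\<integral>\<omega>. max (real (Bin \<omega>) - z) 0 \<partial>N)\<bar>
    \<le> 2 / (pbar * q ^ n) * (\<Sum>i=1..n. M.expectation (R i))" for z
  proof -
    define h where "h k = max (real k - z) 0" for k
    define m where "m = measure_pmf.expectation (binomial_pmf n pbar) h"
    have Bin_exp: "(\<integral>\<omega>. max (real (Bin \<omega>) - z) 0 \<partial>N) = m"
      using integral_distr[OF Bin(1), of h] by (simp add: Bin(2) m_def h_def)
    obtain f where f: "\<And>k. k \<le> n \<Longrightarrow>
        pbar * (real n - real k) * f (Suc k) - (1 - pbar) * real k * f k = h k - m"
      using binomial_stein_equation[OF pbar_bounds, where n = n and h = h] unfolding m_def by blast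
    have h_second: "\<bar>h (k + 2) - 2 * h (k + 1) + h k\<bar> \<le> 1" for k
      by (simp add: h_def max_def)
    define F where "F k = f (min k n)" for k
    have F_lip: "\<bar>F b - F a\<bar> \<le> 1 / 2 * (real b - real a)" if "1 \<le> a" "a \<le> b" for a b
      unfolding F_def
      by (rule binomial_stein_lipschitz[OF _ _ f h_second _ that]) (use pbar_bounds in auto)
    have F_stein: "pbar * (real n - real k) * F (Suc k) - q * real k * F k = h k - m" if "k \<le> n" for k
      using f[OF that] that q by (cases "k = n") (auto simp: F_def)
    have "finite (range F)"
      by (rule finite_subset[of _ "f ` {..n}"]) (auto simp: F_def)
    hence F_bdd: "bounded (range F)" by (rule finite_imp_bounded)
    then obtain C where C: "\<And>k. \<bar>F k\<bar> \<le> C" by (auto simp: bounded_iff)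
    have F_bdd': "bounded (range (\<lambda>k. F (Suc k)))"
      by (rule bounded_subset[OF F_bdd]) auto

    \<comment> \<open>\<open>T i\<close> is the share of index \<open>i\<close> in the Stein equation at \<open>W\<close>; \<open>D i\<close> is a correction of mean
      zero that replaces values of \<open>F\<close> by differences of values of \<open>F\<close>.\<close>
    define T where "T i \<omega> = p i * F (Suc (W \<omega>)) - pbar * (real (X i \<omega>) * F (Suc (W \<omega>)))
      - q * (real (X i \<omega>) * F (W \<omega>))" for i \<omega>
    define D where "D i \<omega> = real (X i \<omega>) * F (Suc (Wi i \<omega>)) - p i * F (Suc (Wi i \<omega>))" for i \<omega>
    have int_T: "integrable M (T i)" and int_D: "integrable M (D i)" if i: "i \<in> {1..n}" for i
      unfolding T_def D_def
      using int_X_bdd[OF i meas_W, of F, OF C] int_X_bdd[OF i meas_W, of "\<lambda>k. F (Suc k)", OF C]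
        int_X_bdd[OF i meas_Wi, of "\<lambda>k. F (Suc k)", OF C]
        int_bdd[OF meas_W, of "\<lambda>k. F (Suc k)", OF C] int_bdd[OF meas_Wi, of "\<lambda>k. F (Suc k)", OF C]
      by auto
    have exp_D: "M.expectation (D i) = 0" if i: "i \<in> {1..n}" for i
    proof -
      have ind: "M.indep_collections X {i} ({1..n} - A i)"
        using dep i by (auto simp: M.locally_dependent_def)
      have "M.expectation (\<lambda>\<omega>. real (X i \<omega>) * F (Suc (Wi i \<omega>)))
          = p i * M.expectation (\<lambda>\<omega>. F (Suc (Wi i \<omega>)))"
        using M.indep_collections_expectation_mult[OF ind _ int_X[OF i] F_bdd']
        by (simp add: Wi exp_X[OF i])
      thus ?thesis
        using int_X_bdd[OF i meas_Wi, of "\<lambda>k. F (Suc k)", OF C]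
          int_bdd[OF meas_Wi, of "\<lambda>k. F (Suc k)", OF C]
        unfolding D_def by simp
    qed

    have AE_stein: "AE \<omega> in M. h (W \<omega>) = m + (\<Sum>i=1..n. T i \<omega>)"
      using AE_W_le
    proof eventually_elim
      case (elim \<omega>)
      have "(\<Sum>i=1..n. real (X i \<omega>)) = real (W \<omega>)" by (simp add: W)
      hence "(\<Sum>i=1..n. T i \<omega>) = pbar * (real n - real (W \<omega>)) * F (Suc (W \<omega>)) - q * real (W \<omega>) * F (W \<omega>)"
        unfolding T_def sum_subtractf sum_distrib_left[symmetric] sum_distrib_right[symmetric] sum_p
        by (simp add: algebra_simps)
      thus ?case using F_stein[OF elim] by simp
    qed
    have AE_term: "AE \<omega> in M. \<bar>T i \<omega> + D i \<omega>\<bar> \<le> 2 / (pbar * q ^ n) * R i \<omega>" if i: "i \<in> {1..n}" for i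
      using AE01 AE_W_le
    proof eventually_elim
      case (elim \<omega>)
      have "i \<in> A i" using dep i by (auto simp: M.locally_dependent_def)
      have "Wi i \<omega> + X i \<omega> = (\<Sum>j\<in>insert i ({1..n} - A i). X j \<omega>)"
        using \<open>i \<in> A i\<close> by (simp add: Wi)
      also have "\<dots> \<le> W \<omega>" unfolding W using i by (intro sum_mono2) auto
      finally have Wi_le: "Wi i \<omega> + X i \<omega> \<le> W \<omega>" .
      let ?a = "real (W \<omega>) - real (Wi i \<omega>)"
      have l1: "\<bar>F (Suc (W \<omega>)) - F (Suc (Wi i \<omega>))\<bar> \<le> 1 / 2 * ?a"
        using F_lip[of "Suc (Wi i \<omega>)" "Suc (W \<omega>)"] Wi_le by simp
      \<comment> \<open>If \<open>X i = 1\<close>, then \<open>i \<in> A i\<close> forces \<open>W \<ge> Wi i + 1\<close>, so the Lipschitz bound applies.\<close>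
      have l2: "\<bar>real (X i \<omega>) * (F (W \<omega>) - F (Suc (Wi i \<omega>)))\<bar> \<le> real (X i \<omega>) * (1 / 2 * ?a)"
      proof (cases "X i \<omega> = 0")
        case False
        hence "X i \<omega> = 1" using elim(1) i by fastforce
        thus ?thesis using F_lip[of "Suc (Wi i \<omega>)" "W \<omega>"] Wi_le by simp
      qed simp
      have "T i \<omega> + D i \<omega> = (p i - pbar * real (X i \<omega>)) * (F (Suc (W \<omega>)) - F (Suc (Wi i \<omega>)))
          - q * (real (X i \<omega>) * (F (W \<omega>) - F (Suc (Wi i \<omega>))))"
        unfolding T_def D_def q by (simp add: algebra_simps)
      also have "\<bar>\<dots>\<bar> \<le> (p i + pbar * real (X i \<omega>)) * (1 / 2 * ?a) + q * (real (X i \<omega>) * (1 / 2 * ?a))"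
      proof -
        have "\<bar>p i - pbar * real (X i \<omega>)\<bar> \<le> p i + pbar * real (X i \<omega>)"
          using p_nonneg[OF i] pbar_bounds by (simp add: abs_le_iff)
        hence "\<bar>(p i - pbar * real (X i \<omega>)) * (F (Suc (W \<omega>)) - F (Suc (Wi i \<omega>)))\<bar>
            \<le> (p i + pbar * real (X i \<omega>)) * (1 / 2 * ?a)"
          unfolding abs_mult using l1 by (intro mult_mono) auto
        moreover have "\<bar>q * (real (X i \<omega>) * (F (W \<omega>) - F (Suc (Wi i \<omega>))))\<bar>
            \<le> q * (real (X i \<omega>) * (1 / 2 * ?a))"
          using mult_left_mono[OF l2, of q] q01 by (subst abs_mult) simp
        ultimately show ?thesis by linarith
      qed
      also have "\<dots> = 1 / 2 * ((p i + real (X i \<omega>)) * ?a)" unfolding q by (simp add: field_simps)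
      also have "\<dots> \<le> 2 * ((p i + real (X i \<omega>)) * ?a)"
        using p_nonneg[OF i] Wi_le by (intro mult_right_mono) auto
      also have "\<dots> = 2 / (pbar * q ^ n) * ((p i + real (X i \<omega>)) * (?a * (pbar * q ^ n)))"
        using pbar_bounds q01(1) by simp
      also have "\<dots> \<le> 2 / (pbar * q ^ n) * R i \<omega>"
      proof (rule mult_left_mono)
        have "(p i + real (X i \<omega>)) * (?a * (pbar * q ^ n))
            \<le> (p i + real (X i \<omega>)) * (q ^ Wi i \<omega> - q ^ W \<omega>)"
          using power_gap_ge[of q "Wi i \<omega>" "W \<omega>" n] p_nonneg[OF i] q01 Wi_le elim(2)
          by (intro mult_left_mono) auto
        also have "\<dots> \<le> R i \<omega>"
        proof -
          have "q * (real (X i \<omega>) * q ^ W \<omega>) \<le> 1 * (real (X i \<omega>) * q ^ W \<omega>)"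
            using q01 by (intro mult_right_mono) auto
          thus ?thesis unfolding R_def by (simp add: algebra_simps)
        qed
        finally show "(p i + real (X i \<omega>)) * (?a * (pbar * q ^ n)) \<le> R i \<omega>" .
      qed (use pbar_bounds q01 in auto)
      finally show ?case .
    qed

    have "(\<integral>\<omega>. h (W \<omega>) \<partial>M) = (\<integral>\<omega>. m + (\<Sum>i=1..n. T i \<omega>) \<partial>M)"
    proof (rule integral_cong_AE)
      show "(\<lambda>\<omega>. m + (\<Sum>i=1..n. T i \<omega>)) \<in> borel_measurable M"
        using int_T by (intro borel_measurable_add borel_measurable_sum) auto
    qed (use AE_stein in auto)
    also have "\<dots> = m + (\<Sum>i=1..n. M.expectation (T i))"
      using int_T by (subst Bochner_Integration.integral_add)
        (auto simp: M.prob_space intro!: Bochner_Integration.integral_sum)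
    also have "\<dots> = m + (\<Sum>i=1..n. M.expectation (\<lambda>\<omega>. T i \<omega> + D i \<omega>))"
      using int_T int_D exp_D by simp
    finally have "\<bar>(\<integral>\<omega>. h (W \<omega>) \<partial>M) - m\<bar> = \<bar>\<Sum>i=1..n. M.expectation (\<lambda>\<omega>. T i \<omega> + D i \<omega>)\<bar>"
      by simp
    also have "\<dots> \<le> (\<Sum>i=1..n. \<bar>M.expectation (\<lambda>\<omega>. T i \<omega> + D i \<omega>)\<bar>)"
      by (rule sum_abs)
    also have "\<dots> \<le> (\<Sum>i=1..n. M.expectation (\<lambda>\<omega>. 2 / (pbar * q ^ n) * R i \<omega>))"
    proof (rule sum_mono)
      fix i assume i: "i \<in> {1..n}"
      have "\<bar>M.expectation (\<lambda>\<omega>. T i \<omega> + D i \<omega>)\<bar> \<le> M.expectation (\<lambda>\<omega>. \<bar>T i \<omega> + D i \<omega>\<bar>)"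
        by (rule integral_abs_bound)
      also have "\<dots> \<le> M.expectation (\<lambda>\<omega>. 2 / (pbar * q ^ n) * R i \<omega>)"
        using int_T[OF i] int_D[OF i] int_R[OF i] AE_term[OF i] by (intro integral_mono_AE) auto
      finally show "\<bar>M.expectation (\<lambda>\<omega>. T i \<omega> + D i \<omega>)\<bar>
        \<le> M.expectation (\<lambda>\<omega>. 2 / (pbar * q ^ n) * R i \<omega>)" .
    qed
    also have "\<dots> = 2 / (pbar * q ^ n) * (\<Sum>i=1..n. M.expectation (R i))"
      by (simp add: sum_distrib_left)
    finally show ?thesis by (simp add: Bin_exp h_def)
  qed
  show ?thesis
    unfolding stop_loss_dist_def
  proof (rule SUP_least)
    fix z :: real
    show "ereal \<bar>(\<integral>\<omega>. max (real (W \<omega>) - z) 0 \<partial>M) - (\<integral>\<omega>. max (real (Bin \<omega>) - z) 0 \<partial>N)\<bar>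
      \<le> ereal (2 / (pbar * q ^ n) *
        (\<Sum>i=1..n. (\<integral>\<omega>. (real (X i \<omega>) + p i) * q ^ Wi i \<omega> \<partial>M)
                  - (\<integral>\<omega>. (p i + q * real (X i \<omega>)) * q ^ W \<omega> \<partial>M)))"
      using bound[of z] by (simp add: exp_R)
  qed
qed

end
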